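(* Let $G,H$ be graphs with $G,H\in\mathfrak{N}$, where $H$ is $r$-regular. Then the strong product $G\boxtimes H$ belongs to $\mathfrak{N}$. Moreover, $w(G\boxtimes H)\leq w(G)\cdot(r+1)+r$ and $W(G\boxtimes H)\geq W(G)\cdot(r+1)+r$.
   Context: All graphs are finite, undirected, without loops or multiple edges. An edge coloring of a graph $G$ with colors $1,2,\ldots,t$ is an interval $t$-coloring if every color $i\in\{1,\ldots,t\}$ is used on at least one edge, and for every vertex $v$ the colors of the edges incident to $v$ are pairwise distinct and form an interval of consecutive integers. $G$ is interval colorable if it has an interval $t$-coloring for some integer $t\geq 1$; $\mathfrak{N}$ denotes the set of interval colorable graphs. For $G\in\mathfrak{N}$, $w(G)$ and $W(G)$ denote the least and greatest $t$ for which $G$ has an interval $t$-coloring. The strong product $G\boxtimes H$ has vertex set $V(G)\times V(H)$, with $(u_1,v_1)$ adjacent to $(u_2,v_2)$ iff either ($u_1u_2\in E(G)$ and $v_1v_2\in E(H)$), or ($u_1=u_2$ and $v_1v_2\in E(H)$), or ($v_1=v_2$ and $u_1u_2\in E(G)$). *)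

theory Defs
  imports Main
begin

record 'a ugraph =
  verts :: "'a set"
  edges :: "'a set set"

text \<open>Two-element edge sets rule out loops, and a set of edges rules out multiple edges.\<close>

definition simple_graph :: "'a ugraph \<Rightarrow> bool" where
  "simple_graph G \<longleftrightarrow>
     finite (verts G) \<and> (\<forall>e\<in>edges G. e \<subseteq> verts G \<and> card e = 2)"

definition incident_edges :: "'a ugraph \<Rightarrow> 'a \<Rightarrow> 'a set set" where
  "incident_edges G v = {e \<in> edges G. v \<in> e}"

definition regular_graph :: "nat \<Rightarrow> 'a ugraph \<Rightarrow> bool" where
  "regular_graph r G \<longleftrightarrow> (\<forall>v\<in>verts G. card (incident_edges G v) = r)"

text \<open>The image equation says both that only colors from 1 to t occur and that each of them
  occurs. The interval at a vertex may be empty (\<open>b < a\<close>), so isolated vertices are harmless.\<close>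

definition interval_coloring :: "'a ugraph \<Rightarrow> nat \<Rightarrow> ('a set \<Rightarrow> nat) \<Rightarrow> bool" where
  "interval_coloring G t c \<longleftrightarrow>
     c ` edges G = {1..t} \<and>
     (\<forall>v\<in>verts G. inj_on c (incident_edges G v) \<and>
        (\<exists>a b. c ` incident_edges G v = {a..b}))"

text \<open>Since \<open>t \<ge> 1\<close>, a graph without edges is not interval colorable.\<close>

definition has_interval_coloring :: "'a ugraph \<Rightarrow> nat \<Rightarrow> bool" where
  "has_interval_coloring G t \<longleftrightarrow> t \<ge> 1 \<and> (\<exists>c. interval_coloring G t c)"

definition interval_colorable_graphs :: "'a ugraph set" where
  "interval_colorable_graphs = {G. simple_graph G \<and> (\<exists>t. has_interval_coloring G t)}"

definition w_min :: "'a ugraph \<Rightarrow> nat" where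
  "w_min G = (LEAST t. has_interval_coloring G t)"

definition W_max :: "'a ugraph \<Rightarrow> nat" where
  "W_max G = (GREATEST t. has_interval_coloring G t)"

definition strong_adj :: "'a ugraph \<Rightarrow> 'b ugraph \<Rightarrow> 'a \<times> 'b \<Rightarrow> 'a \<times> 'b \<Rightarrow> bool" where
  "strong_adj G H p q \<longleftrightarrow>
     ({fst p, fst q} \<in> edges G \<and> {snd p, snd q} \<in> edges H) \<or>
     (fst p = fst q \<and> {snd p, snd q} \<in> edges H) \<or>
     (snd p = snd q \<and> {fst p, fst q} \<in> edges G)"

definition strong_product :: "'a ugraph \<Rightarrow> 'b ugraph \<Rightarrow> ('a \<times> 'b) ugraph" where
  "strong_product G H =
     \<lparr> verts = verts G \<times> verts H,
       edges = {{p, q} | p q.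
         p \<in> verts G \<times> verts H \<and> q \<in> verts G \<times> verts H \<and> strong_adj G H p q} \<rparr>"

text \<open>The number of colors is bounded by the number of edges, so the greatest value exists.\<close>

lemma simple_graph_finite_edges:
  assumes "simple_graph G"
  shows "finite (edges G)"
proof (rule finite_subset)
  show "edges G \<subseteq> Pow (verts G)"
    using assms by (auto simp: simple_graph_def)
  show "finite (Pow (verts G))"
    using assms by (simp add: simple_graph_def)
qed

lemma has_interval_coloring_le_card_edges:
  assumes "simple_graph G" and "has_interval_coloring G t"
  shows "t \<le> card (edges G)"
proof -
  obtain c where "c ` edges G = {1..t}"
    using assms(2) by (auto simp: has_interval_coloring_def interval_coloring_def)
  then show ?thesis
    using card_image_le[OF simple_graph_finite_edges[OF assms(1)], of c] by simp
qed

lemma W_max_greatest: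
  assumes "G \<in> interval_colorable_graphs"
  shows "has_interval_coloring G (W_max G)"
    and "has_interval_coloring G t \<Longrightarrow> t \<le> W_max G"
proof -
  have G: "simple_graph G" and ex: "\<exists>t. has_interval_coloring G t"
    using assms by (auto simp: interval_colorable_graphs_def)
  note bound = has_interval_coloring_le_card_edges[OF G]
  show "has_interval_coloring G (W_max G)"
    unfolding W_max_def using GreatestI_ex_nat[of "has_interval_coloring G"] ex bound by blast
  show "has_interval_coloring G t \<Longrightarrow> t \<le> W_max G"
    unfolding W_max_def using Greatest_le_nat[of "has_interval_coloring G"] bound by blast
qed

lemma w_min_least:
  assumes "G \<in> interval_colorable_graphs"
  shows "has_interval_coloring G (w_min G)"
    and "has_interval_coloring G t \<Longrightarrow> w_min G \<le> t"
  using assms unfolding w_min_def interval_colorable_graphs_def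
  by (auto intro: LeastI_ex Least_le)

lemma simple_graph_strong_product:
  assumes "simple_graph G" and "simple_graph H"
  shows "simple_graph (strong_product G H)"
proof -
  have ne: "u \<noteq> v" if "{u, v} \<in> edges K" "simple_graph K" for u v and K :: "'c ugraph"
    using that by (auto simp: simple_graph_def)
  have "p \<noteq> q" if "strong_adj G H p q" for p q
    using that assms ne by (auto simp: strong_adj_def simple_graph_def)
  then show ?thesis
    using assms by (auto simp: simple_graph_def strong_product_def)
qed

end

theory Submission
  imports Defs
begin

text \<open>Reducing an interval coloring of the \<open>r\<close>-regular graph \<open>H\<close> modulo \<open>r\<close> gives a proper edge
  coloring of \<open>H\<close> with colors \<open>1..r\<close>. Give the vertices of \<open>H\<close> the color 0: the closed neighborhood
  of each vertex then sees every value in \<open>0..r\<close> once. Likewise, if the edges at a vertex \<open>u\<close> of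
  \<open>G\<close> have the colors \<open>l + 1..h\<close>, give \<open>u\<close> itself the color \<open>l\<close>. Coloring an edge of the strong
  product by \<open>(r + 1) * A + B\<close>, where \<open>A\<close> and \<open>B\<close> are the colors of its projections, realizes at
  \<open>(u, v)\<close> all numbers from \<open>(r + 1) * l\<close> to \<open>(r + 1) * h + r\<close> once, and the first of them
  belongs to the vertex \<open>(u, v)\<close> itself, so that the edges still occupy an interval.\<close>

section \<open>Neighborhoods and incident edges\<close>

definition nbhd :: "'a ugraph \<Rightarrow> 'a \<Rightarrow> 'a set" where
  "nbhd G u = {w. {u, w} \<in> edges G}"

lemma nbhd_irrefl:
  assumes "simple_graph G"
  shows "u \<notin> nbhd G u"
  using assms by (auto simp: nbhd_def simple_graph_def)

lemma singleton_notin_edges: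
  assumes "simple_graph G"
  shows "{u} \<notin> edges G"
  using assms by (auto simp: simple_graph_def)

lemma nbhd_subset_verts:
  assumes "simple_graph G"
  shows "nbhd G u \<subseteq> verts G"
  using assms by (auto simp: nbhd_def simple_graph_def)

lemma inj_on_insert_singleton: "inj_on (\<lambda>w. {u, w}) S"
  by (auto simp: inj_on_def doubleton_eq_iff)

text \<open>In a simple graph an edge at \<open>u\<close> has exactly one other endpoint. Colors at
  \<open>u\<close> can thus be studied on neighborhoods, where the strong product takes a Cartesian
  form.\<close>

lemma incident_edges_eq_image_nbhd:
  assumes "simple_graph G"
  shows "incident_edges G u = (\<lambda>w. {u, w}) ` nbhd G u"
proof
  show "incident_edges G u \<subseteq> (\<lambda>w. {u, w}) ` nbhd G u"
  proof
    fix e assume e: "e \<in> incident_edges G u"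
    then have "card e = 2" "u \<in> e" "e \<in> edges G"
      using assms by (auto simp: incident_edges_def simple_graph_def)
    then obtain w where "e = {u, w}"
      by (auto simp: card_2_iff)
    then show "e \<in> (\<lambda>w. {u, w}) ` nbhd G u"
      using \<open>e \<in> edges G\<close> by (auto simp: nbhd_def)
  qed
qed (auto simp: incident_edges_def nbhd_def)

lemma edge_incident_vertexE:
  assumes "simple_graph G" and "e \<in> edges G"
  obtains u where "u \<in> verts G" and "e \<in> incident_edges G u"
proof -
  have "e \<noteq> {}" "e \<subseteq> verts G"
    using assms by (auto simp: simple_graph_def)
  then show thesis
    using assms(2) that by (auto simp: incident_edges_def)
qed

lemma interval_coloring_nbhd:
  assumes "simple_graph G" and "interval_coloring G t c" and "u \<in> verts G"
  shows "inj_on (\<lambda>w. c {u, w}) (nbhd G u)"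
    and "\<exists>a b. (\<lambda>w. c {u, w}) ` nbhd G u = {a..b}"
proof -
  have inj: "inj_on c (incident_edges G u)" and ex: "\<exists>a b. c ` incident_edges G u = {a..b}"
    using assms by (auto simp: interval_coloring_def)
  have "inj_on (c \<circ> (\<lambda>w. {u, w})) (nbhd G u)"
    using inj unfolding incident_edges_eq_image_nbhd[OF assms(1)]
    by (intro comp_inj_on inj_on_insert_singleton)
  then show "inj_on (\<lambda>w. c {u, w}) (nbhd G u)"
    by (simp add: comp_def)
  show "\<exists>a b. (\<lambda>w. c {u, w}) ` nbhd G u = {a..b}"
    using ex unfolding incident_edges_eq_image_nbhd[OF assms(1)] image_image .
qed

section \<open>Interval colorings extended to the vertices\<close>

lemma bij_betw_insert_new:
  assumes "bij_betw f S T" and "x \<notin> S" and "f x \<notin> T"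
  shows "bij_betw f (insert x S) (insert (f x) T)"
  using assms by (auto simp: bij_betw_def)

text \<open>Each vertex color sits directly below the colors of the edges there. \<open>A\<close>
  takes sets so that \<open>A {u, w}\<close> also covers \<open>w = u\<close>, which matches
  projections of product edges that collapse to a vertex. The strict \<open>l u < i\<close> says
  that \<open>i\<close> occurs on an edge at \<open>u\<close>, not just as the color of
  \<open>u\<close>.\<close>

lemma interval_coloring_extend_verts:
  assumes G: "simple_graph G" and c: "interval_coloring G t c"
  obtains A l h where
    "\<forall>u\<in>verts G. A {u} = l u \<and> l u \<le> h u \<and> h u \<le> t \<and>
       bij_betw (\<lambda>w. A {u, w}) (insert u (nbhd G u)) {l u..h u}"
    "\<forall>i\<in>{1..t}. \<exists>u\<in>verts G. l u < i \<and> i \<le> h u"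
proof -
  have range: "c ` edges G = {1..t}"
    using c by (simp add: interval_coloring_def)
  have "\<exists>m n. m \<le> n \<and> n \<le> t \<and> (\<lambda>w. c {u, w}) ` nbhd G u = {Suc m..n}"
    if u: "u \<in> verts G" for u
  proof (cases "nbhd G u = {}")
    case True
    \<comment> \<open>For an isolated vertex \<open>m = n = 0\<close> works, since
      \<open>{Suc 0..0}\<close> is empty.\<close>
    then show ?thesis by (intro exI[of _ 0]) auto
  next
    case False
    obtain a b where ab: "(\<lambda>w. c {u, w}) ` nbhd G u = {a..b}"
      using interval_coloring_nbhd(2)[OF G c u] by blast
    have sub: "{a..b} \<subseteq> {1..t}"
      unfolding ab[symmetric] range[symmetric] by (auto simp: nbhd_def)
    have "a \<le> b"
      using ab False by (metis atLeastatMost_empty_iff image_is_empty)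
    \<comment> \<open>Colors are at least 1, so \<open>a - 1\<close> is not truncated and
      \<open>Suc (a - 1) = a\<close>.\<close>
    then show ?thesis
      using sub ab by (intro exI[of _ "a - 1"] exI[of _ b]) auto
  qed
  then obtain l h where lh: "\<And>u. u \<in> verts G \<Longrightarrow>
      l u \<le> h u \<and> h u \<le> t \<and> (\<lambda>w. c {u, w}) ` nbhd G u = {Suc (l u)..h u}"
    by metis
  \<comment> \<open>Singletons are never edges, so the two cases do not clash;
    \<open>the_elem\<close> reads off the vertex.\<close>
  define A where "A s = (if s \<in> edges G then c s else l (the_elem s))" for s
  have A_vertex: "A {u} = l u" for u
    using singleton_notin_edges[OF G] by (simp add: A_def)
  show thesis
  proof (rule that; intro ballI)
    fix u assume u: "u \<in> verts G"
    have A_edge: "A {u, w} = c {u, w}" if "w \<in> nbhd G u" for w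
      using that by (simp add: A_def nbhd_def)
    have "bij_betw (\<lambda>w. c {u, w}) (nbhd G u) {Suc (l u)..h u}"
      using interval_coloring_nbhd(1)[OF G c u] lh[OF u] by (simp add: bij_betw_def)
    then have "bij_betw (\<lambda>w. A {u, w}) (nbhd G u) {Suc (l u)..h u}"
      using A_edge by (simp cong: bij_betw_cong)
    from bij_betw_insert_new[OF this nbhd_irrefl[OF G]]
    have "bij_betw (\<lambda>w. A {u, w}) (insert u (nbhd G u)) (insert (l u) {Suc (l u)..h u})"
      by (simp add: A_vertex)
    moreover have "insert (l u) {Suc (l u)..h u} = {l u..h u}"
      using lh[OF u] by auto
    ultimately show "A {u} = l u \<and> l u \<le> h u \<and> h u \<le> t \<and>
        bij_betw (\<lambda>w. A {u, w}) (insert u (nbhd G u)) {l u..h u}"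
      using A_vertex lh[OF u] by simp
  next
    fix i assume "i \<in> {1..t}"
    then obtain e where e: "e \<in> edges G" "c e = i"
      using range by (metis imageE)
    obtain u where u: "u \<in> verts G" "e \<in> incident_edges G u"
      using edge_incident_vertexE[OF G e(1)] .
    then have "i \<in> (\<lambda>w. c {u, w}) ` nbhd G u"
      using e(2) unfolding incident_edges_eq_image_nbhd[OF G] by auto
    then show "\<exists>u\<in>verts G. l u < i \<and> i \<le> h u"
      using lh[OF u(1)] by (intro bexI[OF _ u(1)]) auto
  qed
qed

section \<open>Regular graphs and colors modulo r\<close>

lemma bij_betw_mod_interval:
  fixes r :: nat
  assumes "card {a..b} = r" and "r > 0"
  shows "bij_betw (\<lambda>x. x mod r) {a..b} {..<r}"
proof -
  \<comment> \<open>Distinct numbers among \<open>r\<close> consecutive ones differ by less than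
    \<open>r\<close>, hence not by a multiple of \<open>r\<close>; counting then gives every
    residue.\<close>
  have inj: "inj_on (\<lambda>x. x mod r) {a..b}"
  proof (rule linorder_inj_onI')
    fix x y assume "x \<in> {a..b}" "y \<in> {a..b}" "x < y"
    then have "0 < y - x" "y - x < r"
      using assms by auto
    then have "\<not> r dvd y - x"
      by (auto dest: dvd_imp_le)
    then show "x mod r \<noteq> y mod r"
      using \<open>x < y\<close> mod_eq_dvd_iff_nat[of x y r] by auto
  qed
  moreover have "(\<lambda>x. x mod r) ` {a..b} = {..<r}"
  proof (rule card_subset_eq)
    show "card ((\<lambda>x. x mod r) ` {a..b}) = card {..<r}"
      using card_image[OF inj] assms(1) by simp
  qed (use assms(2) in auto)
  ultimately show ?thesis
    by (simp add: bij_betw_def)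
qed

text \<open>By regularity each vertex sees \<open>r\<close> consecutive colors, which represent
  every residue class modulo \<open>r\<close> once. Reduction thus makes the color set the same at
  all vertices, wherever the original intervals start.\<close>

lemma regular_interval_coloring_extend_verts:
  assumes H: "simple_graph H" and c: "interval_coloring H t c"
    and reg: "regular_graph r H"
  obtains B where
    "\<forall>v\<in>verts H. B {v} = 0 \<and>
       bij_betw (\<lambda>w. B {v, w}) (insert v (nbhd H v)) {0..r}"
proof -
  \<comment> \<open>The shift by \<open>Suc\<close> moves the residues to \<open>1..r\<close> and
    reserves 0 for the vertices.\<close>
  define B where "B s = (if s \<in> edges H then Suc (c s mod r) else 0)" for s
  have B_vertex: "B {v} = 0" for v
    using singleton_notin_edges[OF H] by (simp add: B_def)
  show thesis
  proof (rule that, intro ballI)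
    fix v assume v: "v \<in> verts H"
    obtain a b where ab: "(\<lambda>w. c {v, w}) ` nbhd H v = {a..b}"
      using interval_coloring_nbhd(2)[OF H c v] by blast
    have inj: "inj_on (\<lambda>w. c {v, w}) (nbhd H v)"
      using interval_coloring_nbhd(1)[OF H c v] .
    have "card (nbhd H v) = r"
      using reg v card_image[OF inj_on_insert_singleton, of v "nbhd H v"]
      by (simp add: regular_graph_def incident_edges_eq_image_nbhd[OF H])
    then have card: "card {a..b} = r"
      using card_image[OF inj] ab by simp
    have "bij_betw (\<lambda>x. Suc (x mod r)) {a..b} {1..r}"
    proof (cases "r > 0")
      case True
      have "bij_betw Suc {..<r} {1..r}"
        by (simp add: bij_betw_def lessThan_atLeast0 image_Suc_atLeastLessThan
            atLeastLessThanSuc_atLeastAtMost)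
      from bij_betw_trans[OF bij_betw_mod_interval[OF card True] this]
      show ?thesis by (simp add: comp_def)
    next
      \<comment> \<open>Here \<open>mod 0\<close> is the identity, but \<open>{a..b}\<close> and
        \<open>{1..0}\<close> are both empty.\<close>
      case False
      then show ?thesis using card by (auto simp: bij_betw_def)
    qed
    from bij_betw_trans[OF bij_betw_imageI[OF inj ab] this]
    have "bij_betw (\<lambda>w. Suc (c {v, w} mod r)) (nbhd H v) {1..r}"
      by (simp add: comp_def)
    moreover have "B {v, w} = Suc (c {v, w} mod r)" if "w \<in> nbhd H v" for w
      using that by (simp add: B_def nbhd_def)
    ultimately have "bij_betw (\<lambda>w. B {v, w}) (nbhd H v) {1..r}"
      by (simp cong: bij_betw_cong)
    from bij_betw_insert_new[OF this nbhd_irrefl[OF H]]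
    have "bij_betw (\<lambda>w. B {v, w}) (insert v (nbhd H v)) (insert 0 {1..r})"
      by (simp add: B_vertex)
    moreover have "insert 0 {1..r} = {0..r}"
      by auto
    ultimately show "B {v} = 0 \<and> bij_betw (\<lambda>w. B {v, w}) (insert v (nbhd H v)) {0..r}"
      using B_vertex by simp
  qed
qed

section \<open>Coloring the strong product in base r + 1\<close>

lemma bij_betw_mixed_radix:
  fixes l h r :: nat
  assumes "l \<le> h"
  shows "bij_betw (\<lambda>(x, y). x * (r + 1) + y) ({l..h} \<times> {0..r})
    {l * (r + 1)..h * (r + 1) + r}"
proof (rule bij_betw_byWitness[where f' = "\<lambda>k. (k div (r + 1), k mod (r + 1))"])
  show "\<forall>p\<in>{l..h} \<times> {0..r}. ((case p of (x, y) \<Rightarrow> x * (r + 1) + y) div (r + 1),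
      (case p of (x, y) \<Rightarrow> x * (r + 1) + y) mod (r + 1)) = p"
  proof
    fix p assume "p \<in> {l..h} \<times> {0..r}"
    then obtain x y where p: "p = (x, y)" and y: "y < r + 1"
      by auto
    have "(x * (r + 1) + y) div (r + 1) = x"
      using div_mult_self3[of "r + 1" x y] y by simp
    moreover have "(x * (r + 1) + y) mod (r + 1) = y"
      using mod_mult_self3[of x "r + 1" y] y by simp
    ultimately show "((case p of (x, y) \<Rightarrow> x * (r + 1) + y) div (r + 1),
      (case p of (x, y) \<Rightarrow> x * (r + 1) + y) mod (r + 1)) = p"
      by (simp add: p)
  qed
  show "\<forall>k\<in>{l * (r + 1)..h * (r + 1) + r}.
      (case (k div (r + 1), k mod (r + 1)) of (x, y) \<Rightarrow> x * (r + 1) + y) = k"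
    using div_mult_mod_eq[of _ "r + 1"] by simp
  show "(\<lambda>(x, y). x * (r + 1) + y) ` ({l..h} \<times> {0..r}) \<subseteq> {l * (r + 1)..h * (r + 1) + r}"
  proof clarify
    fix x y assume "x \<in> {l..h}" "y \<in> {0..r}"
    then have "l * (r + 1) \<le> x * (r + 1)" "x * (r + 1) \<le> h * (r + 1)" "y \<le> r"
      by (simp_all only: atLeastAtMost_iff mult_le_mono1)
    then show "x * (r + 1) + y \<in> {l * (r + 1)..h * (r + 1) + r}"
      by (simp only: atLeastAtMost_iff trans_le_add1 add_mono)
  qed
  show "(\<lambda>k. (k div (r + 1), k mod (r + 1))) ` {l * (r + 1)..h * (r + 1) + r}
      \<subseteq> {l..h} \<times> {0..r}"
  proof clarify
    fix k assume k: "k \<in> {l * (r + 1)..h * (r + 1) + r}"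
    have "l \<le> k div (r + 1)"
      using k by (simp add: less_eq_div_iff_mult_less_eq)
    \<comment> \<open>The upper end \<open>h * (r + 1) + r\<close> is one less than
      \<open>Suc h * (r + 1)\<close>, which caps the quotient at \<open>h\<close>.\<close>
    moreover have "k < Suc h * (r + 1)"
      using k by simp
    then have "k div (r + 1) < Suc h"
      by (rule less_mult_imp_div_less)
    moreover have "k mod (r + 1) < r + 1"
      by simp
    ultimately show "k div (r + 1) \<in> {l..h} \<and> k mod (r + 1) \<in> {0..r}"
      by simp
  qed
qed

text \<open>Distinct vertices are adjacent exactly when each coordinate is equal or adjacent. Hence
  closed neighborhoods multiply, and only the vertex itself is removed.\<close>

lemma nbhd_strong_product:
  assumes G: "simple_graph G" and H: "simple_graph H"
    and u: "u \<in> verts G" and v: "v \<in> verts H"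
  shows "nbhd (strong_product G H) (u, v) =
    insert u (nbhd G u) \<times> insert v (nbhd H v) - {(u, v)}"
proof -
  \<comment> \<open>An unordered edge may match \<open>p\<close> and \<open>q\<close> in either
    order, so reading adjacency off the edge set relies on symmetry.\<close>
  have adj_sym: "strong_adj G H p q \<longleftrightarrow> strong_adj G H q p" for p q
    by (auto simp: strong_adj_def insert_commute)
  have "q \<in> nbhd (strong_product G H) (u, v) \<longleftrightarrow>
      q \<in> verts G \<times> verts H \<and> strong_adj G H (u, v) q" for q
    using u v adj_sym by (auto simp: nbhd_def strong_product_def doubleton_eq_iff)
  moreover have "q \<in> verts G \<times> verts H \<and> strong_adj G H (u, v) q \<longleftrightarrow>
      q \<in> insert u (nbhd G u) \<times> insert v (nbhd H v) - {(u, v)}" for q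
    using u v nbhd_subset_verts[OF G, of u] nbhd_subset_verts[OF H, of v]
      nbhd_irrefl[OF G, of u] nbhd_irrefl[OF H, of v]
    by (cases q) (auto simp: strong_adj_def nbhd_def)
  ultimately show ?thesis by blast
qed

text \<open>One construction serves both bounds: \<open>t\<close> is arbitrary, so it can be
  \<open>w_min G\<close> or \<open>W_max G\<close>. The color count is the largest number with
  quotient \<open>t\<close> on division by \<open>r + 1\<close>.\<close>

lemma has_interval_coloring_strong_product:
  assumes G: "simple_graph G" and H: "simple_graph H"
    and t: "has_interval_coloring G t" and s: "has_interval_coloring H s"
    and reg: "regular_graph r H"
  shows "has_interval_coloring (strong_product G H) (t * (r + 1) + r)"
proof -
  let ?P = "strong_product G H"
  have P: "simple_graph ?P"
    using simple_graph_strong_product[OF G H] .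
  obtain c where c: "interval_coloring G t c" and t1: "t \<ge> 1"
    using t by (auto simp: has_interval_coloring_def)
  obtain d where d: "interval_coloring H s d" and s1: "s \<ge> 1"
    using s by (auto simp: has_interval_coloring_def)
  obtain A l h where extG: "\<forall>u\<in>verts G. A {u} = l u \<and> l u \<le> h u \<and> h u \<le> t \<and>
       bij_betw (\<lambda>w. A {u, w}) (insert u (nbhd G u)) {l u..h u}"
    and A_onto: "\<forall>i\<in>{1..t}. \<exists>u\<in>verts G. l u < i \<and> i \<le> h u"
    using interval_coloring_extend_verts[OF G c] .
  note A = bspec[OF extG]
  obtain B where extH: "\<forall>v\<in>verts H. B {v} = 0 \<and>
       bij_betw (\<lambda>w. B {v, w}) (insert v (nbhd H v)) {0..r}"
    using regular_interval_coloring_extend_verts[OF H d reg] .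
  note B = bspec[OF extH]
  \<comment> \<open>An edge of \<open>H\<close> exists because \<open>s \<ge> 1\<close>. The color
    set at \<open>(u, v)\<close> will depend only on \<open>u\<close>, so a single \<open>v0\<close>
    is enough to realize all colors.\<close>
  obtain v0 where v0: "v0 \<in> verts H"
  proof -
    have "d ` edges H \<noteq> {}"
      using d s1 by (simp add: interval_coloring_def)
    then show thesis
      using edge_incident_vertexE[OF H] that by blast
  qed
  \<comment> \<open>Each projection of a product edge is an edge or a single vertex;
    \<open>A\<close> and \<open>B\<close> handle both.\<close>
  define C where "C e = A (fst ` e) * (r + 1) + B (snd ` e)" for e
  have C_bij: "bij_betw C (incident_edges ?P (u, v))
      {Suc (l u * (r + 1))..h u * (r + 1) + r}" if u: "u \<in> verts G" and v: "v \<in> verts H" for u v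
  proof -
    let ?N = "insert u (nbhd G u) \<times> insert v (nbhd H v)"
    have "bij_betw (map_prod (\<lambda>w. A {u, w}) (\<lambda>w. B {v, w})) ?N ({l u..h u} \<times> {0..r})"
      using A[OF u] B[OF v] by (intro bij_betw_map_prod) auto
    from bij_betw_trans[OF this bij_betw_mixed_radix]
    have "bij_betw (\<lambda>q. C {(u, v), q}) ?N {l u * (r + 1)..h u * (r + 1) + r}"
      using A[OF u] by (simp add: comp_def C_def case_prod_unfold)
    \<comment> \<open>The degenerate pair stands for the vertex itself. It has the least number in
      the range, so removing it leaves an interval.\<close>
    moreover have "C {(u, v), (u, v)} = l u * (r + 1)"
      using A[OF u] B[OF v] by (simp add: C_def)
    moreover have "l u * (r + 1) \<le> h u * (r + 1) + r"
      using A[OF u] by (intro trans_le_add1 mult_le_mono1) auto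
    ultimately have "bij_betw (\<lambda>q. C {(u, v), q}) (?N - {(u, v)})
        ({l u * (r + 1)..h u * (r + 1) + r} - {l u * (r + 1)})"
      by (intro bij_betw_DiffI) (auto simp: bij_betw_def)
    moreover have "{l u * (r + 1)..h u * (r + 1) + r} - {l u * (r + 1)} =
        {Suc (l u * (r + 1))..h u * (r + 1) + r}"
      by auto
    ultimately have "bij_betw (C \<circ> (\<lambda>q. {(u, v), q})) (nbhd ?P (u, v))
        {Suc (l u * (r + 1))..h u * (r + 1) + r}"
      using nbhd_strong_product[OF G H u v] by (simp add: comp_def)
    then show ?thesis
      using bij_betw_comp_iff[OF bij_betw_imageI[OF inj_on_insert_singleton refl]]
      unfolding incident_edges_eq_image_nbhd[OF P] by metis
  qed
  have verts_P: "verts ?P = verts G \<times> verts H"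
    by (simp add: strong_product_def)
  have "C ` edges ?P = {1..t * (r + 1) + r}"
  proof
    show "C ` edges ?P \<subseteq> {1..t * (r + 1) + r}"
    proof
      fix k assume "k \<in> C ` edges ?P"
      then obtain e where e: "e \<in> edges ?P" "k = C e"
        by blast
      obtain p where "p \<in> verts ?P" "e \<in> incident_edges ?P p"
        using edge_incident_vertexE[OF P e(1)] .
      then obtain u v where u: "u \<in> verts G" and "v \<in> verts H" "e \<in> incident_edges ?P (u, v)"
        unfolding verts_P by auto
      then have "k \<in> {Suc (l u * (r + 1))..h u * (r + 1) + r}"
        using e(2) bij_betw_apply[OF C_bij] by metis
      moreover have "h u * (r + 1) \<le> t * (r + 1)"
        using A[OF u] by (intro mult_le_mono1) auto
      ultimately show "k \<in> {1..t * (r + 1) + r}"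
        by auto
    qed
    show "{1..t * (r + 1) + r} \<subseteq> C ` edges ?P"
    proof
      fix k assume k: "k \<in> {1..t * (r + 1) + r}"
      \<comment> \<open>For \<open>k \<le> r\<close> the quotient is 0, which is no edge color of
        \<open>G\<close>. Raising it to 1 selects a vertex with \<open>l u = 0\<close>, where these
        small colors occur.\<close>
      let ?i = "max 1 (k div (r + 1))"
      have "k < Suc t * (r + 1)"
        using k by simp
      then have "k div (r + 1) < Suc t"
        by (rule less_mult_imp_div_less)
      then have "?i \<in> {1..t}"
        using t1 by auto
      then obtain u where u: "u \<in> verts G" "l u < ?i" "?i \<le> h u"
        using A_onto by blast
      have "l u * (r + 1) < k"
      proof (cases "k div (r + 1) = 0")
        case True
        then show ?thesis using u(2) k by simp
      next
        case False
        then have "l u < k div (r + 1)"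
          using u(2) by simp
        \<comment> \<open>As \<open>l u\<close> is strictly below the quotient, \<open>k\<close>
          lies past the whole block of numbers with quotient \<open>l u\<close>.\<close>
        then have "Suc (l u) * (r + 1) \<le> k"
          by (simp add: less_eq_div_iff_mult_less_eq flip: Suc_le_eq)
        then show ?thesis by simp
      qed
      moreover have "k \<le> h u * (r + 1) + r"
      proof -
        have "k = k div (r + 1) * (r + 1) + k mod (r + 1)"
          by (simp only: div_mult_mod_eq)
        also have "\<dots> \<le> h u * (r + 1) + r"
          using u(3) by (intro add_mono mult_le_mono1) (auto simp: less_Suc_eq_le[symmetric])
        finally show ?thesis .
      qed
      ultimately have "k \<in> C ` incident_edges ?P (u, v0)"
        using bij_betw_imp_surj_on[OF C_bij[OF u(1) v0]] by simp
      then show "k \<in> C ` edges ?P"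
        by (auto simp: incident_edges_def)
    qed
  qed
  moreover have "inj_on C (incident_edges ?P p) \<and> (\<exists>a b. C ` incident_edges ?P p = {a..b})"
    if "p \<in> verts ?P" for p
    using that C_bij unfolding verts_P bij_betw_def by blast
  ultimately have "interval_coloring ?P (t * (r + 1) + r) C"
    by (simp add: interval_coloring_def)
  moreover have "t * (r + 1) + r \<ge> 1"
    using t1 by simp
  ultimately show ?thesis
    unfolding has_interval_coloring_def by blast
qed

theorem theorem14:
  fixes G :: "'a ugraph" and H :: "'b ugraph" and r :: nat
  assumes "simple_graph G" and "simple_graph H"
    and "G \<in> interval_colorable_graphs" and "H \<in> interval_colorable_graphs"
    and "regular_graph r H"
  shows "strong_product G H \<in> interval_colorable_graphs \<and>
    w_min (strong_product G H) \<le> w_min G * (r + 1) + r \<and>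
    W_max (strong_product G H) \<ge> W_max G * (r + 1) + r"
proof -
  have P: "has_interval_coloring (strong_product G H) (t * (r + 1) + r)"
    if "has_interval_coloring G t" for t
    \<comment> \<open>\<open>w_min H\<close> supplies some interval coloring of
      \<open>H\<close>.\<close>
    using has_interval_coloring_strong_product[OF assms(1,2) that _ assms(5)]
      w_min_least(1)[OF assms(4)] .
  note P_min = P[OF w_min_least(1)[OF assms(3)]]
  note P_max = P[OF W_max_greatest(1)[OF assms(3)]]
  have "strong_product G H \<in> interval_colorable_graphs"
    using simple_graph_strong_product[OF assms(1,2)] P_min
    by (auto simp: interval_colorable_graphs_def)
  then show ?thesis
    using w_min_least(2)[OF _ P_min] W_max_greatest(2)[OF _ P_max] by blast
qed

end
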